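(* Let $k\ge 2$ and $n\ge 2k-1$ be fixed integers, and let $q\ge n$ be a prime power. There exists an $(n,k,q;1)$ Reed--Solomon sunflower $\mathcal{S}$ with center $\langle\underline{1}\rangle_{\mathbb{F}_q}$ and $$|\mathcal{S}|\ \ge\ \frac{1}{2(k-1)^{n-2}}\,q^{n-2k+2}(1+o(1))=\Omega_{k,n}(q^{n-2k+2}),$$ where the asymptotics are taken as $q\to\infty$.
   Context: $\underline{1}=(1,\ldots,1)$. For $\underline{\alpha}\in\mathbb{F}_q^n$ with pairwise distinct entries, the Reed--Solomon (RS) code is $\mathsf{RS}_{n,k}(\underline{\alpha})=\{(f(\alpha_1),\ldots,f(\alpha_n)) : f\in\mathbb{F}_q[x],\ \deg f<k\}$, a $k$-dimensional subspace of $\mathbb{F}_q^n$. For $1\le c<k\le n\le q$, an $(n,k,q;c)$ Reed--Solomon sunflower is a family of $k$-dimensional RS codes in $\mathbb{F}_q^n$ for which there is a fixed $c$-dimensional subspace $E\subseteq\mathbb{F}_q^n$ (the center) such that any two distinct members of the family intersect exactly in $E$. $o(1)$ denotes a quantity tending to $0$ as $q\to\infty$ with $k,n$ fixed; $\Omega_{k,n}$ hides a positive constant depending only on $k,n$. *)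

theory Defs
  imports
    "HOL-Algebra.Polynomials"
    "HOL-Library.Landau_Symbols"
    "HOL-Number_Theory.Prime_Powers"
    "Jordan_Normal_Form.Missing_VectorSpace"
begin

text \<open>
  Asymptotics in the field size \<open>q\<close> need a quantifier over fields inside a formula, so fields are
  records with an explicit carrier rather than instances of a type class.
  Coordinates are indexed by \<open>0, \<dots>, n - 1\<close>, and vectors are \<open>undefined\<close> outside \<open>{..<n}\<close>, so that
  equality of vectors is equality of functions.
\<close>

abbreviation coord_space :: "('a, 'b) ring_scheme \<Rightarrow> nat \<Rightarrow> ('a, nat \<Rightarrow> 'a) module" where
  "coord_space F n \<equiv> ring.func_space F {..<n}"

definition ones_vec :: "('a, 'b) ring_scheme \<Rightarrow> nat \<Rightarrow> nat \<Rightarrow> 'a" where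
  "ones_vec F n = (\<lambda>i\<in>{..<n}. \<one>\<^bsub>F\<^esub>)"

text \<open>
  The zero polynomial \<open>[]\<close> has \<open>degree [] = 0\<close>, so for \<open>k \<ge> 1\<close> the condition \<open>degree f < k\<close> admits it,
  in agreement with the convention that its degree is \<open>-\<infinity>\<close>.
\<close>

definition rs_code :: "('a, 'b) ring_scheme \<Rightarrow> nat \<Rightarrow> nat \<Rightarrow> (nat \<Rightarrow> 'a) \<Rightarrow> (nat \<Rightarrow> 'a) set" where
  "rs_code F n k \<alpha> =
     {(\<lambda>i\<in>{..<n}. ring.eval F f (\<alpha> i)) | f. f \<in> carrier (univ_poly F (carrier F)) \<and> degree f < k}"

definition is_rs_code :: "('a, 'b) ring_scheme \<Rightarrow> nat \<Rightarrow> nat \<Rightarrow> (nat \<Rightarrow> 'a) set \<Rightarrow> bool" where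
  "is_rs_code F n k C \<longleftrightarrow>
     (\<exists>\<alpha> \<in> carrier (coord_space F n). inj_on \<alpha> {..<n} \<and> C = rs_code F n k \<alpha>)"

text \<open>
  An \<open>(n, k, q; c)\<close> Reed--Solomon sunflower \<open>S\<close> with center \<open>E\<close>, over a field \<open>F\<close> with \<open>q\<close> elements.
  Its members are automatically \<open>k\<close>-dimensional, because \<open>k \<le> n\<close> and evaluation points are distinct.
\<close>

definition rs_sunflower ::
    "('a, 'b) ring_scheme \<Rightarrow> nat \<Rightarrow> nat \<Rightarrow> nat \<Rightarrow> (nat \<Rightarrow> 'a) set set \<Rightarrow> (nat \<Rightarrow> 'a) set \<Rightarrow> bool" where
  "rs_sunflower F n k c S E \<longleftrightarrow>
     1 \<le> c \<and> c < k \<and> k \<le> n \<and> n \<le> order F \<and>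
     VectorSpace.subspace F E (coord_space F n) \<and>
     vectorspace.dim F ((coord_space F n)\<lparr>carrier := E\<rparr>) = c \<and>
     (\<forall>C\<in>S. is_rs_code F n k C) \<and>
     (\<forall>C\<in>S. \<forall>D\<in>S. C \<noteq> D \<longrightarrow> C \<inter> D = E)"

end

theory Submission
  imports Defs "HOL-Algebra.Polynomial_Divisibility"
begin

text \<open>
  An affine change of the variable permutes the polynomials of degree less than \<open>k\<close>, so every
  Reed--Solomon code has evaluation points \<open>\<alpha>\<close> with \<open>\<alpha> 0 = 0\<close> and \<open>\<alpha> 1 = 1\<close>. Call such \<open>\<alpha>\<close>
  normalized; there are at least \<open>(q - n) ^ (n - 2)\<close> of them (\<open>card_normalized_points_ge\<close>). Every
  code contains the constant vectors. Call two points bad for each other if their codes share a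
  nonconstant vector. A set of pairwise good normalized points yields a sunflower, and by greedy
  choice (\<open>exists_large_independent_set\<close>) there is such a set of size at least the number of
  normalized points divided by the maximal number \<open>D\<close> of points that are bad for a given one.

  To bound \<open>D\<close>, fix \<open>\<alpha>\<close> and let \<open>\<beta>\<close> be bad for it: some nonconstant vector has coordinates
  \<open>f (\<alpha> i) = g (\<beta> i)\<close> with \<open>f\<close> and \<open>g\<close> of degree less than \<open>k\<close>. The common vectors form a linear space
  that contains the constants, so subtracting a constant and rescaling gives
  \<open>f 0 = g 0 = 0\<close> and \<open>f 1 = g 1 = e\<close> with \<open>e\<close> either \<open>0\<close> or \<open>1\<close> (\<open>obtain_normalized_witness\<close>). For each
  \<open>e\<close>, interpolation leaves at most \<open>q ^ (k - 2)\<close> choices for \<open>f\<close> and as many for \<open>g\<close>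
  (\<open>card_normalized_polys_le\<close>). Once \<open>f\<close> and \<open>g\<close> are chosen, each of the remaining \<open>n - 2\<close>
  coordinates \<open>\<beta> i\<close> is one of the at most \<open>k - 1\<close> roots of \<open>g - f (\<alpha> i)\<close>. Hence
  \<open>D \<le> 2 * q ^ (2 * k - 4) * (k - 1) ^ (n - 2)\<close> (\<open>card_bad_points_le\<close>), and the quotient is the
  claimed bound with \<open>1 + \<epsilon> q = (1 - n / q) ^ (n - 2)\<close>. The factor \<open>2\<close> in the theorem is the
  number of values of \<open>e\<close>.
\<close>

section \<open>Greedy choice of an independent set\<close>

text \<open>
  By maximality, every vertex is bad for some member of a maximal independent set \<open>T\<close>, so the
  neighbourhoods of the members of \<open>T\<close> cover all vertices. Reflexivity makes a member of \<open>T\<close> belong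
  to its own neighbourhood.
\<close>

lemma exists_large_independent_set:
  fixes bad :: "'v \<Rightarrow> 'v \<Rightarrow> bool"
  assumes fin: "finite V"
    and sym: "\<And>a b. bad a b \<Longrightarrow> bad b a"
    and refl: "\<And>a. a \<in> V \<Longrightarrow> bad a a"
    and deg: "\<And>a. a \<in> V \<Longrightarrow> card {b \<in> V. bad a b} \<le> D"
  shows "\<exists>T\<subseteq>V. (\<forall>a\<in>T. \<forall>b\<in>T. a \<noteq> b \<longrightarrow> \<not> bad a b) \<and> card V \<le> card T * D"
proof -
  define indep where "indep = {T. T \<subseteq> V \<and> (\<forall>a\<in>T. \<forall>b\<in>T. a \<noteq> b \<longrightarrow> \<not> bad a b)}"
  have "finite indep" "indep \<noteq> {}"
    using fin by (auto simp: indep_def)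
  from finite_has_maximal[OF this] obtain T where
    T: "T \<in> indep" and max: "\<And>U. U \<in> indep \<Longrightarrow> T \<subseteq> U \<Longrightarrow> T = U"
    by blast
  have TV: "T \<subseteq> V" using T by (auto simp: indep_def)
  have "V \<subseteq> (\<Union>a\<in>T. {b \<in> V. bad a b})"
  proof
    fix b assume b: "b \<in> V"
    show "b \<in> (\<Union>a\<in>T. {b \<in> V. bad a b})"
    proof (rule ccontr)
      assume neg: "b \<notin> (\<Union>a\<in>T. {b \<in> V. bad a b})"
      then have "insert b T \<in> indep"
        using T b sym by (auto simp: indep_def)
      with max have "b \<in> T" by blast
      with neg refl[OF b] b show False by blast
    qed
  qed
  then have "card V \<le> card (\<Union>a\<in>T. {b \<in> V. bad a b})"
    using fin TV by (intro card_mono) (auto intro: finite_subset)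
  also have "\<dots> \<le> (\<Sum>a\<in>T. card {b \<in> V. bad a b})"
    using fin TV by (intro card_UN_le) (auto intro: finite_subset)
  also have "\<dots> \<le> card T * D"
    using sum_bounded_above[of T "\<lambda>a. card {b \<in> V. bad a b}" D] deg TV by auto
  finally show ?thesis
    using T by (auto simp: indep_def)
qed

section \<open>Polynomials of bounded degree\<close>

definition (in ring) polys_lt :: "nat \<Rightarrow> 'a list set" where
  "polys_lt k = {f \<in> carrier (poly_ring R). degree f < k}"

context field
begin

lemma polys_ltD: "f \<in> polys_lt k \<Longrightarrow> f \<in> carrier (poly_ring R)" "f \<in> polys_lt k \<Longrightarrow> degree f < k"
  by (auto simp: polys_lt_def)

lemma eval_polys_lt_closed: "f \<in> polys_lt k \<Longrightarrow> x \<in> carrier R \<Longrightarrow> eval f x \<in> carrier R"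
  by (intro eval_poly_in_carrier[OF carrier_is_subring])
     (auto simp: polys_lt_def univ_poly_carrier)

lemma polys_lt_minus:
  assumes f: "f \<in> polys_lt k" and g: "g \<in> polys_lt k"
  shows "f \<ominus>\<^bsub>poly_ring R\<^esub> g \<in> polys_lt k"
    and "\<And>x. x \<in> carrier R \<Longrightarrow> eval (f \<ominus>\<^bsub>poly_ring R\<^esub> g) x = eval f x \<ominus> eval g x"
proof -
  interpret UP: domain "poly_ring R"
    by (rule univ_poly_is_domain[OF carrier_is_subring])
  note fg = polys_ltD[OF f] polys_ltD[OF g]
  have "degree (f \<ominus>\<^bsub>poly_ring R\<^esub> g) \<le> max (degree f) (degree (\<ominus>\<^bsub>poly_ring R\<^esub> g))"
    unfolding a_minus_def univ_poly_add by (rule poly_add_degree)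
  also have "\<dots> < k"
    using fg univ_poly_a_inv_degree[OF carrier_is_subring fg(3)] by simp
  finally show "f \<ominus>\<^bsub>poly_ring R\<^esub> g \<in> polys_lt k"
    using fg by (auto simp: polys_lt_def)
  fix x assume "x \<in> carrier R"
  then interpret ev: ring_hom_ring "poly_ring R" R "\<lambda>p. eval p x"
    by (rule eval_ring_hom[OF carrier_is_subring])
  show "eval (f \<ominus>\<^bsub>poly_ring R\<^esub> g) x = eval f x \<ominus> eval g x"
    using fg by (simp add: a_minus_def)
qed

lemma const_in_polys_lt:
  assumes "a \<in> carrier R" "0 < k"
  shows "poly_of_const a \<in> polys_lt k"
    and "\<And>x. x \<in> carrier R \<Longrightarrow> eval (poly_of_const a) x = a"
proof -
  have "poly_of_const a \<in> {p \<in> carrier (poly_ring R). degree p = 0}"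
    using poly_of_const_over_carrier assms by blast
  then show "poly_of_const a \<in> polys_lt k"
    using assms by (auto simp: polys_lt_def)
  fix x assume "x \<in> carrier R"
  then show "eval (poly_of_const a) x = a"
    using assms by (simp add: poly_of_const_def)
qed

text \<open>This operation puts a common vector of two codes into normal form.\<close>

lemma polys_lt_affine:
  assumes f: "f \<in> polys_lt k" and sb: "s \<in> carrier R" "b \<in> carrier R"
  obtains g where "g \<in> polys_lt k"
    and "\<And>x. x \<in> carrier R \<Longrightarrow> eval g x = s \<otimes> (eval f x \<ominus> b)"
proof -
  interpret UP: domain "poly_ring R"
    by (rule univ_poly_is_domain[OF carrier_is_subring])
  have k: "0 < k" using polys_ltD[OF f] by simp
  define h where "h = f \<ominus>\<^bsub>poly_ring R\<^esub> poly_of_const b"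
  note h = polys_lt_minus[OF f const_in_polys_lt(1)[OF sb(2) k], folded h_def]
  note S = const_in_polys_lt[OF sb(1), of 1, simplified]
  define g where "g = poly_of_const s \<otimes>\<^bsub>poly_ring R\<^esub> h"
  have carr: "poly_of_const s \<in> carrier (poly_ring R)" "h \<in> carrier (poly_ring R)"
    using S(1) h(1) by (auto dest: polys_ltD)
  have "degree g \<le> degree (poly_of_const s) + degree h"
    unfolding g_def univ_poly_mult
    using poly_mult_degree_eq[OF carrier_is_subring, of "poly_of_const s" h] carr
    by (auto simp: univ_poly_carrier)
  also have "\<dots> < k"
    using S(1) polys_ltD[OF h(1)] polys_ltD[OF S(1)] by simp
  finally have "g \<in> polys_lt k"
    using carr by (auto simp: g_def polys_lt_def)
  moreover have "eval g x = s \<otimes> (eval f x \<ominus> b)" if x: "x \<in> carrier R" for x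
  proof -
    interpret ev: ring_hom_ring "poly_ring R" R "\<lambda>p. eval p x"
      by (rule eval_ring_hom[OF carrier_is_subring x])
    show ?thesis
      using carr S h(2)[OF x] const_in_polys_lt(2)[OF sb(2) k x] x by (simp add: g_def)
  qed
  ultimately show ?thesis by (rule that)
qed

lemma card_poly_roots_le_degree:
  assumes p: "p \<in> carrier (poly_ring R)" "p \<noteq> []"
  shows "finite {x \<in> carrier R. eval p x = \<zero>}"
    and "card {x \<in> carrier R. eval p x = \<zero>} \<le> degree p"
proof -
  have eq: "{x \<in> carrier R. eval p x = \<zero>} = set_mset (roots p)"
    using roots_mem_iff_is_root[OF p(1)] p(2) by (auto simp: is_root_def)
  show "finite {x \<in> carrier R. eval p x = \<zero>}" by (simp add: eq)
  have "card (set_mset M) \<le> size M" for M :: "'a multiset"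
    by (induction M) (auto simp: card_insert_if)
  from le_trans[OF this size_roots_le_degree[OF p(1)]] eq
  show "card {x \<in> carrier R. eval p x = \<zero>} \<le> degree p" by simp
qed

text \<open>
  The value \<open>eval g y \<noteq> c\<close> guarantees that \<open>g - c\<close> is not the zero polynomial, whose roots would
  be the whole field.
\<close>

lemma card_poly_fibre_le:
  assumes g: "g \<in> polys_lt k" and c: "c \<in> carrier R"
    and y: "y \<in> carrier R" "eval g y \<noteq> c"
  shows "finite {x \<in> carrier R. eval g x = c}" "card {x \<in> carrier R. eval g x = c} \<le> k - 1"
proof -
  have k: "0 < k" using polys_ltD[OF g] by simp
  note C = const_in_polys_lt[OF c k]
  define p where "p = g \<ominus>\<^bsub>poly_ring R\<^esub> poly_of_const c"
  note p = polys_lt_minus[OF g C(1), folded p_def]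
  have ev: "eval p x = \<zero> \<longleftrightarrow> eval g x = c" if "x \<in> carrier R" for x
    using that p(2)[OF that] C(2)[OF that] eval_polys_lt_closed[OF g that] c by simp
  have "p \<noteq> []" using ev[OF y(1)] y(2) by auto
  note r = card_poly_roots_le_degree[OF polys_ltD(1)[OF p(1)] this]
  have eq: "{x \<in> carrier R. eval g x = c} = {x \<in> carrier R. eval p x = \<zero>}"
    using ev by auto
  show "finite {x \<in> carrier R. eval g x = c}" "card {x \<in> carrier R. eval g x = c} \<le> k - 1"
    using r polys_ltD(2)[OF p(1)] unfolding eq by auto
qed

lemma polys_lt_eqI:
  assumes f: "f \<in> polys_lt k" and g: "g \<in> polys_lt k"
    and A: "A \<subseteq> carrier R" "k \<le> card A"
    and agree: "\<And>x. x \<in> A \<Longrightarrow> eval f x = eval g x"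
  shows "f = g"
proof (rule ccontr)
  assume ne: "f \<noteq> g"
  interpret UP: domain "poly_ring R"
    by (rule univ_poly_is_domain[OF carrier_is_subring])
  define p where "p = f \<ominus>\<^bsub>poly_ring R\<^esub> g"
  note p = polys_lt_minus[OF f g, folded p_def]
  have "p \<noteq> []"
    using UP.r_right_minus_eq[OF polys_ltD(1)[OF f] polys_ltD(1)[OF g]] ne
    by (simp only: p_def univ_poly_zero not_False_eq_True)
  note r = card_poly_roots_le_degree[OF polys_ltD(1)[OF p(1)] this]
  have "A \<subseteq> {x \<in> carrier R. eval p x = \<zero>}"
    using A p(2) agree eval_polys_lt_closed[OF g] by (auto simp: subset_iff)
  from card_mono[OF r(1) this] r(2) A polys_ltD(2)[OF p(1)] show False by simp
qed

text \<open>
  A polynomial of degree less than \<open>k\<close> is determined by its values at \<open>k\<close> points. Two of them are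
  prescribed here, so the values at \<open>k - 2\<close> further points determine it.
\<close>

lemma card_normalized_polys_le:
  assumes fin: "finite (carrier R)" and k: "2 \<le> k" and kq: "k \<le> order R"
  shows "finite {f \<in> polys_lt k. eval f \<zero> = \<zero> \<and> eval f \<one> = e}" (is "finite ?P")
    and "card {f \<in> polys_lt k. eval f \<zero> = \<zero> \<and> eval f \<one> = e} \<le> order R ^ (k - 2)"
proof -
  have "k - 2 \<le> card (carrier R - {\<zero>, \<one>})"
    using fin kq by (simp add: order_def card_Diff_subset)
  then obtain A where A: "A \<subseteq> carrier R - {\<zero>, \<one>}" "card A = k - 2" "finite A"
    by (rule obtain_subset_with_card_n)
  let ?r = "\<lambda>f. \<lambda>x\<in>A. eval f x"
  have inj: "inj_on ?r ?P"
  proof (rule inj_onI)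
    fix f g assume f: "f \<in> ?P" and g: "g \<in> ?P" and eq: "?r f = ?r g"
    show "f = g"
    proof (rule polys_lt_eqI[of f k g "insert \<zero> (insert \<one> A)"])
      show "k \<le> card (insert \<zero> (insert \<one> A))"
        using A k by (subst card_insert_disjoint; (subst card_insert_disjoint)?) auto
      fix x assume "x \<in> insert \<zero> (insert \<one> A)"
      then show "eval f x = eval g x"
        using f g fun_cong[OF eq, of x] by auto
    qed (use f g A in auto)
  qed
  have im: "?r ` ?P \<subseteq> A \<rightarrow>\<^sub>E carrier R"
  proof (intro image_subsetI, unfold restrict_PiE_iff, rule ballI)
    fix f x assume f: "f \<in> ?P" and x: "x \<in> A"
    show "eval f x \<in> carrier R"
      by (rule eval_polys_lt_closed[of f k]) (use f x A(1) in blast)+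
  qed
  have finE: "finite (A \<rightarrow>\<^sub>E carrier R)"
    using A fin by (intro finite_PiE) auto
  show "finite ?P"
    using inj im finE by (rule inj_on_finite)
  have "card ?P \<le> card (A \<rightarrow>\<^sub>E carrier R)"
    using inj im finE by (rule card_inj_on_le)
  also have "\<dots> = order R ^ (k - 2)"
    using A by (simp add: card_funcsetE order_def)
  finally show "card ?P \<le> order R ^ (k - 2)" .
qed

end

section \<open>Constant vectors in Reed--Solomon codes\<close>

definition (in ring) constants :: "nat \<Rightarrow> (nat \<Rightarrow> 'a) set" where
  "constants n = {(\<lambda>i\<in>{..<n}. a) | a. a \<in> carrier R}"

context field
begin

lemma mem_rs_code: "v \<in> rs_code R n k \<alpha> \<longleftrightarrow> (\<exists>f\<in>polys_lt k. v = (\<lambda>i\<in>{..<n}. eval f (\<alpha> i)))"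
  by (auto simp: rs_code_def polys_lt_def)

lemma constants_subset_rs_code:
  assumes "0 < k" "\<alpha> \<in> {..<n} \<rightarrow>\<^sub>E carrier R"
  shows "constants n \<subseteq> rs_code R n k \<alpha>"
proof
  fix v assume "v \<in> constants n"
  then obtain a where a: "a \<in> carrier R" "v = (\<lambda>i\<in>{..<n}. a)" by (auto simp: constants_def)
  note C = const_in_polys_lt[OF a(1) assms(1)]
  have "v = (\<lambda>i\<in>{..<n}. eval (poly_of_const a) (\<alpha> i))"
    unfolding a(2) using C(2) assms(2) by (intro restrict_ext) (auto simp: PiE_iff)
  with C(1) show "v \<in> rs_code R n k \<alpha>" by (auto simp: mem_rs_code)
qed

text \<open>
  This vector comes from the polynomial \<open>X\<close>. For distinct points it is not constant, so a code is
  strictly larger than the center, and codes that meet only in the center are different.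
\<close>

lemma points_in_rs_code:
  assumes "2 \<le> k" "\<alpha> \<in> {..<n} \<rightarrow>\<^sub>E carrier R"
  shows "\<alpha> \<in> rs_code R n k \<alpha>"
proof -
  have "X \<in> polys_lt k"
    using var_closed[OF carrier_is_subring] assms(1) by (auto simp: polys_lt_def var_def)
  moreover have "\<alpha> = (\<lambda>i\<in>{..<n}. eval X (\<alpha> i))"
    using assms(2) eval_var by (intro ext) (auto simp: PiE_iff extensional_def)
  ultimately show ?thesis by (auto simp: mem_rs_code)
qed

lemma vectorspace_coord_space: "vectorspace R (coord_space R n)"
  using func_space_is_module by (simp add: vectorspace_def field_axioms)

lemma span_ones_vec: "LinearCombinations.module.span R (coord_space R n) {ones_vec R n} = constants n"
proof -
  interpret V: vectorspace R "coord_space R n" by (rule vectorspace_coord_space)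
  have ones: "ones_vec R n \<in> carrier (coord_space R n)"
    by (auto simp: ones_vec_def func_space_def)
  have lc: "V.lincomb a {ones_vec R n} = (\<lambda>i\<in>{..<n}. a (ones_vec R n))"
    if "a (ones_vec R n) \<in> carrier R" for a
  proof -
    have "V.lincomb a {ones_vec R n} = a (ones_vec R n) \<odot>\<^bsub>coord_space R n\<^esub> ones_vec R n"
      using that ones by (simp add: V.lincomb_def)
    also have "\<dots> = (\<lambda>i\<in>{..<n}. a (ones_vec R n))"
      using that by (auto simp: func_space_def ones_vec_def)
    finally show ?thesis .
  qed
  have "V.span {ones_vec R n} = {V.lincomb a {ones_vec R n} | a. a \<in> {ones_vec R n} \<rightarrow> carrier R}"
    using ones by (intro V.finite_span) auto
  also have "\<dots> = constants n"
  proof (intro equalityI subsetI)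
    fix v assume "v \<in> constants n"
    then obtain a where a: "a \<in> carrier R" "v = (\<lambda>i\<in>{..<n}. a)" by (auto simp: constants_def)
    then have "v = V.lincomb (\<lambda>_. a) {ones_vec R n}" using lc[of "\<lambda>_. a"] by simp
    with a show "v \<in> {V.lincomb a {ones_vec R n} | a. a \<in> {ones_vec R n} \<rightarrow> carrier R}"
      by blast
  next
    fix v assume "v \<in> {V.lincomb a {ones_vec R n} | a. a \<in> {ones_vec R n} \<rightarrow> carrier R}"
    then show "v \<in> constants n" using lc by (auto simp: constants_def)
  qed
  finally show ?thesis .
qed

lemma span_ones_vec_line:
  assumes n: "0 < n"
  shows "VectorSpace.subspace R (LinearCombinations.module.span R (coord_space R n) {ones_vec R n})
           (coord_space R n)"
    and "vectorspace.dim R ((coord_space R n)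
           \<lparr>carrier := LinearCombinations.module.span R (coord_space R n) {ones_vec R n}\<rparr>) = 1"
proof -
  interpret V: vectorspace R "coord_space R n" by (rule vectorspace_coord_space)
  have ones: "ones_vec R n \<in> carrier (coord_space R n)"
    by (auto simp: ones_vec_def func_space_def)
  let ?E = "V.span {ones_vec R n}"
  show sub: "VectorSpace.subspace R ?E (coord_space R n)"
    using ones by (intro V.span_is_subspace) auto
  have inE: "ones_vec R n \<in> ?E"
    by (rule V.span_self[OF ones])
  interpret E: vectorspace R "V.vs ?E" by (rule V.subspace_is_vs[OF sub])
  have "submodule R ?E (coord_space R n)"
    using sub by (simp add: VectorSpace.subspace_def)
  then have "E.span {ones_vec R n} = ?E"
    using inE by (intro V.span_li_not_depend) auto
  moreover have "ones_vec R n \<noteq> \<zero>\<^bsub>coord_space R n\<^esub>"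
  proof
    assume "ones_vec R n = \<zero>\<^bsub>coord_space R n\<^esub>"
    then have "ones_vec R n 0 = \<zero>\<^bsub>coord_space R n\<^esub> 0" by simp
    with n show False by (simp add: ones_vec_def func_space_def)
  qed
  ultimately show "E.dim = 1"
    using inE by (intro E.dim1I) auto
qed

end

section \<open>Counting normalized evaluation points\<close>

definition (in ring) normalized_points :: "nat \<Rightarrow> (nat \<Rightarrow> 'a) set" where
  "normalized_points n =
     {\<alpha> \<in> {..<n} \<rightarrow>\<^sub>E carrier R. inj_on \<alpha> {..<n} \<and> \<alpha> 0 = \<zero> \<and> \<alpha> 1 = \<one>}"

context field
begin

lemma normalized_pointsD:
  assumes "\<alpha> \<in> normalized_points n"
  shows "\<alpha> \<in> {..<n} \<rightarrow>\<^sub>E carrier R" "inj_on \<alpha> {..<n}" "\<alpha> 0 = \<zero>" "\<alpha> (Suc 0) = \<one>"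
    "\<And>i. i < n \<Longrightarrow> \<alpha> i \<in> carrier R"
  using assms by (auto simp: normalized_points_def)

text \<open>
  If the first two coordinates of the common vector \<open>v\<close> differ, then \<open>(v - v 0) / (v 1 - v 0)\<close> starts
  with \<open>0, 1\<close>. Otherwise \<open>v - v 0\<close> starts with \<open>0, 0\<close>. The points \<open>y\<close> and \<open>z\<close> witness that \<open>g\<close>
  is not constant.
\<close>

lemma obtain_normalized_witness:
  assumes k: "0 < k" and n: "2 \<le> n"
    and \<alpha>: "\<alpha> \<in> normalized_points n" and \<beta>: "\<beta> \<in> normalized_points n"
    and bad: "rs_code R n k \<alpha> \<inter> rs_code R n k \<beta> \<noteq> constants n"
  obtains e f g y z where "e \<in> {\<zero>, \<one>}"
    and "f \<in> polys_lt k" "eval f \<zero> = \<zero>" "eval f \<one> = e"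
    and "g \<in> polys_lt k" "eval g \<zero> = \<zero>" "eval g \<one> = e"
    and "y \<in> carrier R" "z \<in> carrier R" "eval g y \<noteq> eval g z"
    and "\<And>i. i < n \<Longrightarrow> eval g (\<beta> i) = eval f (\<alpha> i)"
proof -
  note A = normalized_pointsD[OF \<alpha>] and B = normalized_pointsD[OF \<beta>]
  obtain v where v: "v \<in> rs_code R n k \<alpha>" "v \<in> rs_code R n k \<beta>" "v \<notin> constants n"
    using bad constants_subset_rs_code[OF k A(1)] constants_subset_rs_code[OF k B(1)] by blast
  then obtain f0 g0 where f0: "f0 \<in> polys_lt k" "v = (\<lambda>i\<in>{..<n}. eval f0 (\<alpha> i))"
    and g0: "g0 \<in> polys_lt k" "v = (\<lambda>i\<in>{..<n}. eval g0 (\<beta> i))"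
    unfolding mem_rs_code by blast
  have vf: "v i = eval f0 (\<alpha> i)" and vg: "v i = eval g0 (\<beta> i)" if "i < n" for i
    using that fun_cong[OF f0(2), of i] fun_cong[OF g0(2), of i] by simp_all
  have vc: "v i \<in> carrier R" if "i < n" for i
    using vf[OF that] eval_polys_lt_closed[OF f0(1) A(5)[OF that]] by simp
  obtain j where j: "j < n" "v j \<noteq> v 0"
  proof (rule ccontr)
    assume "\<not> thesis"
    with that have "v = (\<lambda>i\<in>{..<n}. v 0)"
      using f0(2) by (intro ext) (auto simp: restrict_def)
    then show False using v(3) vc[of 0] n by (auto simp: constants_def)
  qed
  define d where "d = v 1 \<ominus> v 0"
  define s where "s = (if d = \<zero> then \<one> else inv d)"
  define e where "e = s \<otimes> d"
  have v01: "v 0 \<in> carrier R" "v 1 \<in> carrier R" using vc n by auto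
  then have d: "d \<in> carrier R" by (simp add: d_def)
  then have s: "s \<in> carrier R" "s \<noteq> \<zero>" and e: "e \<in> {\<zero>, \<one>}"
    using d Units_inv_Units[of d] by (auto simp: s_def e_def field_Units)
  obtain f where f: "f \<in> polys_lt k" "\<And>x. x \<in> carrier R \<Longrightarrow> eval f x = s \<otimes> (eval f0 x \<ominus> v 0)"
    using polys_lt_affine[OF f0(1) s(1) v01(1)] by blast
  obtain g where g: "g \<in> polys_lt k" "\<And>x. x \<in> carrier R \<Longrightarrow> eval g x = s \<otimes> (eval g0 x \<ominus> v 0)"
    using polys_lt_affine[OF g0(1) s(1) v01(1)] by blast
  have ef: "eval f (\<alpha> i) = s \<otimes> (v i \<ominus> v 0)" and eg: "eval g (\<beta> i) = s \<otimes> (v i \<ominus> v 0)"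
    if "i < n" for i
    using that f(2) g(2) vf vg A(5) B(5) by simp_all
  have 0: "s \<otimes> (v 0 \<ominus> v 0) = \<zero>" using s v01 by (simp add: a_minus_def r_neg)
  show ?thesis
  proof (rule that[of e f g "\<beta> j" "\<beta> 0"])
    show "eval f \<zero> = \<zero>" "eval g \<zero> = \<zero>"
      using ef[of 0] eg[of 0] 0 n A(3) B(3) by auto
    show "eval f \<one> = e" "eval g \<one> = e"
      using ef[of 1] eg[of 1] n A(4) B(4) by (auto simp: e_def d_def)
    show "eval g (\<beta> j) \<noteq> eval g (\<beta> 0)"
    proof -
      have "s \<otimes> (v j \<ominus> v 0) \<noteq> \<zero>"
        using s v01 vc[OF j(1)] j(2) by (simp add: integral_iff)
      then show ?thesis using eg[OF j(1)] eg[of 0] 0 n by simp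
    qed
  qed (use e f(1) g(1) ef eg B(5) j n in auto)
qed

text \<open>
  The coordinates \<open>0\<close> and \<open>1\<close> of \<open>\<beta>\<close> are prescribed, and each of the others lies in a fibre of
  the nonconstant polynomial \<open>g\<close>.
\<close>

lemma card_normalized_points_over_poly_le:
  assumes g: "g \<in> polys_lt k" and yz: "y \<in> carrier R" "z \<in> carrier R" "eval g y \<noteq> eval g z"
    and c: "\<And>i. i < n \<Longrightarrow> c i \<in> carrier R" and n: "2 \<le> n"
  shows "finite {\<beta> \<in> normalized_points n. \<forall>i<n. eval g (\<beta> i) = c i}" (is "finite ?B")
    and "card {\<beta> \<in> normalized_points n. \<forall>i<n. eval g (\<beta> i) = c i} \<le> (k - 1) ^ (n - 2)"
proof -
  define Y where "Y = (\<lambda>i::nat. if i = 0 then {\<zero>} else if i = 1 then {\<one>}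
                                else {x \<in> carrier R. eval g x = c i})"
  have fibre: "finite {x \<in> carrier R. eval g x = c i}"
      "card {x \<in> carrier R. eval g x = c i} \<le> k - 1" if "i < n" for i
  proof -
    obtain w where "w \<in> carrier R" "eval g w \<noteq> c i" using yz by metis
    from card_poly_fibre_le[OF g c[OF that] this]
    show "finite {x \<in> carrier R. eval g x = c i}"
      "card {x \<in> carrier R. eval g x = c i} \<le> k - 1" by auto
  qed
  have sub: "?B \<subseteq> PiE {..<n} Y"
    by (auto simp: normalized_points_def Y_def PiE_iff extensional_def)
  have fin: "finite (PiE {..<n} Y)"
    using fibre by (intro finite_PiE) (auto simp: Y_def)
  show "finite ?B" using sub fin by (rule finite_subset)
  have split: "{..<n} = insert 0 (insert 1 {2..<n})" using n by auto
  have "card ?B \<le> card (PiE {..<n} Y)"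
    using fin sub by (rule card_mono)
  also have "\<dots> = (\<Prod>i<n. card (Y i))"
    by (simp add: card_PiE)
  also have "\<dots> = (\<Prod>i=2..<n. card (Y i))"
    unfolding split by (simp add: Y_def)
  also have "\<dots> \<le> (\<Prod>i=2..<n. k - 1)"
    using fibre by (intro prod_mono) (auto simp: Y_def)
  also have "\<dots> = (k - 1) ^ (n - 2)" by simp
  finally show "card ?B \<le> (k - 1) ^ (n - 2)" .
qed

text \<open>
  The normalized pairs \<open>(f, g)\<close> form the set \<open>I\<close>. Only those with nonconstant \<open>g\<close>, the set \<open>J\<close>,
  may enter the union over fibres, since a fibre of a constant can be the whole field.
\<close>

lemma card_bad_points_le:
  assumes fin: "finite (carrier R)" and k: "2 \<le> k" and kn: "k \<le> n" and nq: "n \<le> order R"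
    and \<alpha>: "\<alpha> \<in> normalized_points n"
  shows "card {\<beta> \<in> normalized_points n. rs_code R n k \<alpha> \<inter> rs_code R n k \<beta> \<noteq> constants n}
           \<le> 2 * order R ^ (2 * k - 4) * (k - 1) ^ (n - 2)" (is "card ?Bad \<le> _")
proof -
  let ?P = "\<lambda>e. {f \<in> polys_lt k. eval f \<zero> = \<zero> \<and> eval f \<one> = e}"
  define I where "I = (\<Union>e\<in>{\<zero>, \<one>}. ?P e \<times> ?P e)"
  define J where "J = {(f, g) \<in> I. \<exists>y\<in>carrier R. \<exists>z\<in>carrier R. eval g y \<noteq> eval g z}"
  define Fib where
    "Fib = (\<lambda>(f, g). {\<beta> \<in> normalized_points n. \<forall>i<n. eval g (\<beta> i) = eval f (\<alpha> i)})"
  have kq: "k \<le> order R" using kn nq by simp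
  note P = card_normalized_polys_le[OF fin k kq]
  have finI: "finite I" using P(1) unfolding I_def by blast
  then have finJ: "finite J" by (rule finite_subset[rotated]) (auto simp: J_def)
  have "card I \<le> (\<Sum>e\<in>{\<zero>, \<one>}. card (?P e \<times> ?P e))"
    unfolding I_def by (rule card_UN_le) simp
  also have "\<dots> \<le> (\<Sum>e\<in>{\<zero>, \<one>}. order R ^ (2 * k - 4))"
  proof (rule sum_mono)
    fix e
    have "card (?P e \<times> ?P e) \<le> order R ^ (k - 2) * order R ^ (k - 2)"
      using mult_mono[OF P(2)[of e] P(2)[of e]] by (simp add: card_cartesian_product)
    also have "\<dots> = order R ^ (2 * k - 4)"
      using k by (simp flip: power_add add: mult_2)
    finally show "card (?P e \<times> ?P e) \<le> order R ^ (2 * k - 4)" .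
  qed
  also have "\<dots> = 2 * order R ^ (2 * k - 4)" by simp
  finally have cardI: "card I \<le> 2 * order R ^ (2 * k - 4)" .
  have "J \<subseteq> I" by (auto simp: J_def)
  from le_trans[OF card_mono[OF finI this] cardI]
  have cardJ: "card J \<le> 2 * order R ^ (2 * k - 4)" .
  have Fib: "finite (Fib p) \<and> card (Fib p) \<le> (k - 1) ^ (n - 2)" if "p \<in> J" for p
  proof -
    obtain f g y z where p: "p = (f, g)" "f \<in> polys_lt k" "g \<in> polys_lt k"
      "y \<in> carrier R" "z \<in> carrier R" "eval g y \<noteq> eval g z"
      using \<open>p \<in> J\<close> by (auto simp: J_def I_def)
    have "eval f (\<alpha> i) \<in> carrier R" if "i < n" for i
      using eval_polys_lt_closed[OF p(2)] normalized_pointsD(5)[OF \<alpha> that] .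
    from card_normalized_points_over_poly_le[OF p(3-6) this] k kn show ?thesis
      by (simp add: Fib_def p(1))
  qed
  have "?Bad \<subseteq> (\<Union>p\<in>J. Fib p)"
  proof
    fix \<beta> assume "\<beta> \<in> ?Bad"
    then have \<beta>: "\<beta> \<in> normalized_points n"
      "rs_code R n k \<alpha> \<inter> rs_code R n k \<beta> \<noteq> constants n" by auto
    obtain e f g y z where "e \<in> {\<zero>, \<one>}"
      "f \<in> polys_lt k" "eval f \<zero> = \<zero>" "eval f \<one> = e"
      "g \<in> polys_lt k" "eval g \<zero> = \<zero>" "eval g \<one> = e"
      "y \<in> carrier R" "z \<in> carrier R" "eval g y \<noteq> eval g z"
      "\<And>i. i < n \<Longrightarrow> eval g (\<beta> i) = eval f (\<alpha> i)"
      by (rule obtain_normalized_witness[OF _ _ \<alpha> \<beta>]) (use k kn in auto)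
    then have "(f, g) \<in> J" "\<beta> \<in> Fib (f, g)"
      using \<beta>(1) by (auto simp: J_def I_def Fib_def)
    then show "\<beta> \<in> (\<Union>p\<in>J. Fib p)" by blast
  qed
  then have "card ?Bad \<le> card (\<Union>p\<in>J. Fib p)"
    using Fib finJ by (intro card_mono) auto
  also have "\<dots> \<le> (\<Sum>p\<in>J. card (Fib p))"
    by (rule card_UN_le[OF finJ])
  also have "\<dots> \<le> card J * (k - 1) ^ (n - 2)"
    using sum_bounded_above[of J "\<lambda>p. card (Fib p)" "(k - 1) ^ (n - 2)"] Fib by auto
  also have "\<dots> \<le> 2 * order R ^ (2 * k - 4) * (k - 1) ^ (n - 2)"
    by (rule mult_right_mono[OF cardJ]) simp
  finally show ?thesis .
qed

text \<open>
  Normalized points extend an injective choice of the \<open>n - 2\<close> other coordinates among the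
  \<open>q - 2\<close> elements different from \<open>0\<close> and \<open>1\<close>. Each factor of the falling factorial
  that counts these choices is at least \<open>q - n\<close>.
\<close>

lemma card_normalized_points_ge:
  assumes fin: "finite (carrier R)" and n: "2 \<le> n" and nq: "n \<le> order R"
  shows "(order R - n) ^ (n - 2) \<le> card (normalized_points n)"
    and "finite (normalized_points n)"
proof -
  let ?C = "carrier R - {\<zero>, \<one>}"
  let ?G = "{f \<in> {2..<n} \<rightarrow>\<^sub>E ?C. inj_on f {2..<n}}"
  let ?h = "\<lambda>f. \<lambda>i\<in>{..<n}. if i = 0 then \<zero> else if i = 1 then \<one> else f i"
  show finV: "finite (normalized_points n)"
  proof (rule finite_subset)
    show "normalized_points n \<subseteq> {..<n} \<rightarrow>\<^sub>E carrier R"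
      unfolding normalized_points_def by blast
    show "finite ({..<n} \<rightarrow>\<^sub>E carrier R)"
      using fin by (simp add: finite_PiE)
  qed
  have cC: "card ?C = order R - 2"
    using fin by (simp add: order_def card_Diff_subset)
  have inj: "inj_on ?h ?G"
  proof (rule inj_onI)
    fix f g assume f: "f \<in> ?G" and g: "g \<in> ?G" and eq: "?h f = ?h g"
    show "f = g"
    proof (rule PiE_ext[of f "{2..<n}" "\<lambda>_. ?C" g])
      fix i assume "i \<in> {2..<n}"
      then show "f i = g i" using fun_cong[OF eq, of i] by (simp split: if_splits)
    qed (use f g in auto)
  qed
  have im: "?h ` ?G \<subseteq> normalized_points n"
  proof
    fix b assume "b \<in> ?h ` ?G"
    then obtain f where f: "f \<in> {2..<n} \<rightarrow>\<^sub>E ?C" "inj_on f {2..<n}" and b: "b = ?h f" by auto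
    have fC: "f i \<in> carrier R" "f i \<noteq> \<zero>" "f i \<noteq> \<one>" if "1 < i" "i < n" for i
      using that f(1) PiE_mem[OF f(1), of i] by auto
    have b0: "b i = \<zero> \<longleftrightarrow> i = 0" and b1: "b i = \<one> \<longleftrightarrow> i = 1" and b2: "1 < i \<Longrightarrow> b i = f i"
      if "i < n" for i
      using that fC[of i] unfolding b by (cases "i = 0"; cases "i = 1"; simp)+
    have "inj_on b {..<n}"
    proof (rule inj_onI)
      fix i j assume ij: "i \<in> {..<n}" "j \<in> {..<n}" and eq: "b i = b j"
      have "i = 0 \<longleftrightarrow> j = 0" "i = 1 \<longleftrightarrow> j = 1"
        using b0 b1 ij eq by (metis lessThan_iff)+
      then consider "i = j" | "1 < i" "1 < j" by linarith
      then show "i = j"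
      proof cases
        case 2
        with ij b2 eq have "f i = f j" by (metis lessThan_iff)
        with f(2) 2 ij show ?thesis by (auto dest: inj_onD)
      qed
    qed
    then show "b \<in> normalized_points n"
      using n fC by (auto simp: normalized_points_def b)
  qed
  have "(order R - n) ^ (n - 2) = (\<Prod>i\<in>{0..<n - 2}. order R - n)" by simp
  also have "\<dots> \<le> (\<Prod>i\<in>{0..<n - 2}. card ?C - i)"
    unfolding cC by (intro prod_mono) auto
  also have "\<dots> = card ?G"
    using card_inj_on_subset_funcset[of "{2..<n}" ?C "{2..<n}"] fin by simp
  also have "\<dots> \<le> card (normalized_points n)"
    using inj im finV by (rule card_inj_on_le)
  finally show "(order R - n) ^ (n - 2) \<le> card (normalized_points n)" .
qed

section \<open>The sunflower and its size\<close>

lemma exists_rs_sunflower: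
  assumes fin: "finite (carrier R)" and k: "2 \<le> k" and kn: "k \<le> n" and nq: "n \<le> order R"
  shows "\<exists>S. rs_sunflower R n k 1 S
               (LinearCombinations.module.span R (coord_space R n) {ones_vec R n}) \<and>
             (order R - n) ^ (n - 2) \<le> card S * (2 * order R ^ (2 * k - 4) * (k - 1) ^ (n - 2))"
proof -
  let ?C = "rs_code R n k"
  let ?D = "2 * order R ^ (2 * k - 4) * (k - 1) ^ (n - 2)"
  define bad where "bad = (\<lambda>\<alpha> \<beta>. ?C \<alpha> \<inter> ?C \<beta> \<noteq> constants n)"
  have n: "2 \<le> n" using k kn by simp
  have refl: "bad \<alpha> \<alpha>" if "\<alpha> \<in> normalized_points n" for \<alpha>
  proof -
    note A = normalized_pointsD[OF that]
    have "\<alpha> \<notin> constants n"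
    proof
      assume "\<alpha> \<in> constants n"
      then have "\<alpha> 0 = \<alpha> (Suc 0)" using n by (auto simp: constants_def)
      then show False using A(3,4) by simp
    qed
    with points_in_rs_code[OF k A(1)] show ?thesis by (auto simp: bad_def)
  qed
  have "\<exists>T\<subseteq>normalized_points n. (\<forall>\<alpha>\<in>T. \<forall>\<beta>\<in>T. \<alpha> \<noteq> \<beta> \<longrightarrow> \<not> bad \<alpha> \<beta>) \<and>
          card (normalized_points n) \<le> card T * ?D"
  proof (rule exists_large_independent_set)
    show "finite (normalized_points n)"
      by (rule card_normalized_points_ge(2)[OF fin n nq])
    show "bad \<beta> \<alpha>" if "bad \<alpha> \<beta>" for \<alpha> \<beta>
      using that by (simp add: bad_def Int_commute)
    show "card {\<beta> \<in> normalized_points n. bad \<alpha> \<beta>} \<le> ?D"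
      if "\<alpha> \<in> normalized_points n" for \<alpha>
      unfolding bad_def by (rule card_bad_points_le[OF assms that])
  qed (rule refl)
  then obtain T where T: "T \<subseteq> normalized_points n"
    and indep: "\<forall>\<alpha>\<in>T. \<forall>\<beta>\<in>T. \<alpha> \<noteq> \<beta> \<longrightarrow> \<not> bad \<alpha> \<beta>"
    and large: "card (normalized_points n) \<le> card T * ?D"
    by blast
  have good: "?C \<alpha> \<inter> ?C \<beta> = constants n" if "\<alpha> \<in> T" "\<beta> \<in> T" "\<alpha> \<noteq> \<beta>" for \<alpha> \<beta>
    using indep that unfolding bad_def by blast
  \<comment> \<open>Two points with the same code would be bad for each other, as each is bad for itself.\<close>
  have inj: "inj_on ?C T"
  proof (rule inj_onI, rule ccontr)
    fix \<alpha> \<beta> assume ab: "\<alpha> \<in> T" "\<beta> \<in> T" "?C \<alpha> = ?C \<beta>" "\<alpha> \<noteq> \<beta>"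
    from good[OF ab(1,2,4)] ab(3) have "\<not> bad \<alpha> \<alpha>" by (simp add: bad_def)
    with refl ab(1) T show False by blast
  qed
  have "is_rs_code R n k (?C \<alpha>)" if "\<alpha> \<in> T" for \<alpha>
    using normalized_pointsD[of \<alpha> n] that T by (auto simp: is_rs_code_def func_space_def)
  then have "\<forall>C\<in>?C ` T. is_rs_code R n k C" by blast
  moreover have "\<forall>C\<in>?C ` T. \<forall>D\<in>?C ` T. C \<noteq> D \<longrightarrow> C \<inter> D = constants n"
    using good by blast
  ultimately have "rs_sunflower R n k 1 (?C ` T)
      (LinearCombinations.module.span R (coord_space R n) {ones_vec R n})"
    using span_ones_vec_line[of n] n k kn nq
    unfolding rs_sunflower_def span_ones_vec by simp
  moreover have "(order R - n) ^ (n - 2) \<le> card (?C ` T) * ?D"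
    using card_normalized_points_ge(1)[OF fin n nq] large by (simp add: card_image[OF inj])
  ultimately show ?thesis by blast
qed

end

theorem proposition3p23:
  fixes k n :: nat
  assumes "k \<ge> 2" and "n \<ge> 2 * k - 1"
  shows "\<exists>\<epsilon> :: nat \<Rightarrow> real. \<epsilon> \<in> o(\<lambda>_. 1) \<and>
    (\<forall>q. primepow q \<and> q \<ge> n \<longrightarrow>
      (\<forall>F :: ('a, 'b) ring_scheme. field F \<and> order F = q \<longrightarrow>
        (\<exists>S. rs_sunflower F n k 1 S
               (LinearCombinations.module.span F (coord_space F n) {ones_vec F n}) \<and>
             real (card S) \<ge>
               1 / (2 * real (k - 1) ^ (n - 2)) * real q ^ (n + 2 - 2 * k) * (1 + \<epsilon> q)))) \<and>
    (\<lambda>q. 1 / (2 * real (k - 1) ^ (n - 2)) * real q ^ (n + 2 - 2 * k) * (1 + \<epsilon> q))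
      \<in> \<Omega>(\<lambda>q. real q ^ (n + 2 - 2 * k))"
proof -
  \<comment> \<open>This is the relative loss in estimating the number of normalized points by
      \<open>(q - n) ^ (n - 2)\<close> instead of \<open>q ^ (n - 2)\<close>.\<close>
  define \<epsilon> :: "nat \<Rightarrow> real" where "\<epsilon> = (\<lambda>q. (1 - real n / real q) ^ (n - 2) - 1)"
  let ?K = "real (k - 1) ^ (n - 2)"
  have K: "?K > 0" using assms by simp
  have "(\<lambda>q. (1 - real n / real q) ^ (n - 2) - 1) \<longlonglongrightarrow> (1 - 0) ^ (n - 2) - 1"
    by (intro tendsto_diff tendsto_power tendsto_const lim_const_over_n)
  then have lim: "\<epsilon> \<longlonglongrightarrow> 0" by (simp add: \<epsilon>_def)
  then have "\<epsilon> \<in> o(\<lambda>_. 1)" by (intro smalloI_tendsto) auto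
  moreover have "\<exists>S. rs_sunflower F n k 1 S
               (LinearCombinations.module.span F (coord_space F n) {ones_vec F n}) \<and>
             real (card S) \<ge> 1 / (2 * ?K) * real q ^ (n + 2 - 2 * k) * (1 + \<epsilon> q)"
    if q: "primepow q" "q \<ge> n" and F: "field F" "order F = q"
    for q and F :: "('a, 'b) ring_scheme"
  proof -
    interpret F: field F by (rule F)
    have q0: "q > 0" using q(1) by (rule primepow_gt_0_nat)
    have kn: "k \<le> n" using assms by linarith
    have fin: "finite (carrier F)"
      using q0 F(2) by (auto simp: order_def card_gt_0_iff)
    obtain S where S: "rs_sunflower F n k 1 S
          (LinearCombinations.module.span F (coord_space F n) {ones_vec F n})"
      and le: "(q - n) ^ (n - 2) \<le> card S * (2 * q ^ (2 * k - 4) * (k - 1) ^ (n - 2))"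
      using F.exists_rs_sunflower[OF fin assms(1) kn] q(2) unfolding F(2) by blast
    \<comment> \<open>The exponent in the theorem arises by dividing \<open>q ^ (n - 2)\<close> by the power of \<open>q\<close> in the
        bound on bad points.\<close>
    have exponent: "(n + 2 - 2 * k) + (2 * k - 4) = n - 2" using assms by simp
    have "real q ^ (n + 2 - 2 * k) * real q ^ (2 * k - 4) * (1 + \<epsilon> q)
        = real q ^ (n - 2) * (1 - real n / real q) ^ (n - 2)"
      unfolding power_add[symmetric] exponent by (simp add: \<epsilon>_def)
    also have "\<dots> = (real q * (1 - real n / real q)) ^ (n - 2)"
      by (rule power_mult_distrib[symmetric])
    also have "real q * (1 - real n / real q) = real (q - n)"
      using q0 q(2) by (simp add: field_simps of_nat_diff)
    also have "real (q - n) ^ (n - 2) \<le> real (card S) * (2 * real q ^ (2 * k - 4) * ?K)"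
      using of_nat_mono[OF le, where 'a = real]
      by (simp only: of_nat_mult of_nat_power of_nat_numeral)
    finally have "(real q ^ (n + 2 - 2 * k) * (1 + \<epsilon> q)) * real q ^ (2 * k - 4)
        \<le> (real (card S) * (2 * ?K)) * real q ^ (2 * k - 4)"
      by (simp only: mult_ac)
    then have "real q ^ (n + 2 - 2 * k) * (1 + \<epsilon> q) \<le> real (card S) * (2 * ?K)"
      by (rule mult_right_le_imp_le) (use q0 in simp)
    then have "real q ^ (n + 2 - 2 * k) * (1 + \<epsilon> q) / (2 * ?K) \<le> real (card S)"
      using K by (subst pos_divide_le_eq) auto
    then have "1 / (2 * ?K) * real q ^ (n + 2 - 2 * k) * (1 + \<epsilon> q) \<le> real (card S)"
      by (simp only: times_divide_eq_left mult_1_left)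
    with S show ?thesis by blast
  qed
  moreover have "(\<lambda>q. 1 / (2 * ?K) * real q ^ (n + 2 - 2 * k) * (1 + \<epsilon> q))
      \<in> \<Omega>(\<lambda>q. real q ^ (n + 2 - 2 * k))"
  proof (rule landau_omega.bigI)
    show "1 / (4 * ?K) > 0" using K by simp
    have "eventually (\<lambda>q. \<epsilon> q > - 1 / 2) sequentially"
      using order_tendstoD(1)[OF lim, of "- 1 / 2"] by simp
    then show "eventually (\<lambda>q. norm (1 / (2 * ?K) * real q ^ (n + 2 - 2 * k) * (1 + \<epsilon> q))
        \<ge> 1 / (4 * ?K) * norm (real q ^ (n + 2 - 2 * k))) sequentially"
    proof eventually_elim
      case (elim q)
      let ?c = "1 / (2 * ?K) * real q ^ (n + 2 - 2 * k)"
      have "1 / (4 * ?K) * norm (real q ^ (n + 2 - 2 * k)) = ?c * (1 / 2)" by simp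
      also have "\<dots> \<le> ?c * (1 + \<epsilon> q)"
        using elim by (intro mult_left_mono) auto
      also have "\<dots> \<le> norm (?c * (1 + \<epsilon> q))"
        unfolding real_norm_def by (rule abs_ge_self)
      finally show ?case .
    qed
  qed
  ultimately show ?thesis by blast
qed

end
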